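(* The algorithm WFAST solves the $(W,\epsilon,M)$-Volume Estimation problem: after processing any $(\mathcal U,M)$-weighted stream, for every $x\in\mathcal U$, the value $\widehat{v^W_x}$ returned by WinQuery$(x)$ satisfies $$v^W_x\le\widehat{v^W_x}\le v^W_x+W\cdot M\cdot\epsilon .$$
   Context: Streams. Given a set $\mathcal U$ (the universe of ids) and a positive integer $M$, a $(\mathcal U,M)$-weighted stream of length $N$ is a sequence $\langle p_1,\dots,p_N\rangle$ with $p_i=(d_i,w_i)\in\mathcal U\times\{1,\dots,M\}$ (id and weight). For a positive integer window size $W$, the window volume of $x$ is $v^W_x=\sum_{i\in\{N-W+1,\dots,N\},\,d_i=x}w_i$, the total weight of packets with id $x$ among the last $W$ packets. Algorithm FAST$(M,\delta,\phi)$ (with $\delta>0$, $\phi\ge 0$). Let $s=\lfloor M\phi/2+1\rfloor$ and $\mathfrak C=\lceil (1+\phi)/\delta\rceil$. State: a set $C\subseteq\mathcal U$ and non-negative integers $c_x,r_x$ for $x\in\mathcal U$; initially $C=\emptyset$, $c_x=r_x=0$. Add$(x,w)$: if $x\in C$ or $|C|<\mathfrak C$, set $c_x\gets c_x+\lfloor (r_x+w)/s\rfloor$, $r_x\gets (r_x+w)\bmod s$ (both using the old $r_x$), $C\gets C\cup\{x\}$; otherwise choose an arbitrary $m\in\arg\min_{y\in C}c_y$, set $c_x\gets c_m+\lfloor (s-1+w)/s\rfloor$, $r_x\gets (s-1+w)\bmod s$, $C\gets (C\setminus\{m\})\cup\{x\}$. Query$(x)$: if $x\in C$ or $|C|<\mathfrak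 C$, return $r_x+s c_x$; otherwise return $s-1+s\min_{y\in C}c_y$. A flush resets the instance to its initial state. Algorithm WFAST, with window size $W$, maximal weight $M$, accuracy $\epsilon>0$ and parameter $\phi$. Let $k=\lceil 4/\epsilon\rceil$; it is assumed that $W/k$ is an integer. The stream is partitioned into frames of $W$ packets, each split into $k$ blocks of $W/k$ packets. State: a FAST instance $y=$ FAST$(M,1/k,\phi)$; an offset $o$, initially $0$; a (FIFO) queue $b$ of $k+1$ (FIFO) queues of ids, initially all empty, whose head is the queue of the current (newest) block and whose tail is the queue of the oldest block; and a table $B$ of integer counts indexed by ids, initially empty. Add$(x,w)$: 1. $o\gets (o+1)\bmod W$. 2. If $o=0$ (new frame), flush $y$. 3. If $o\bmod (W/k)=0$ (new block), remove the oldest (tail) queue from $b$ and append a new empty queue as the head. 4. If the tail queue of $b$ is not empty, pop its oldest id $z$, decrease $B[z]$ by $1$, and remove $z$ from $B$ if $B[z]=0$. 5. Let $\pi=\left\lfloor \frac{y.\mathrm{Query}(x)}{MW/k}\right\rfloor$, then call $y.\mathrm{Add}(x,w)$. 6. If now $\left\lfloor \frac{y.\mathrm{Query}(x)}{MW/k}\right\rfloor>\pi$ ($x$ overflows), push $x$ onto the head queue of $b$, and increase $B[x]$ by $1$ (setting $B[x]=1$ if $x$ was not in $B$). WinQuery$(x)$: if $x$ is in $B$, return $\frac{MW}{k}(B[x]+2)+\left(y.\mathrm{Query}(x)\bmod \frac{MW}{k}\right)$; otherwise return $2\frac{MW}{k}+y.\mathrm{Query}(x)$. Processing the stream means calling Add$(d_i,w_i)$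 for $i=1,\dots,N$ in order. *)

theory Defs
  imports Complex_Main
begin

definition weighted_stream :: "'a set \<Rightarrow> nat \<Rightarrow> ('a \<times> nat) list \<Rightarrow> bool" where
  "weighted_stream U M ps \<longleftrightarrow> set ps \<subseteq> U \<times> {1..M}"

text \<open>
  Packets are indexed from 0, so the last \<open>W\<close> of \<open>N\<close> packets are those with index in
  \<open>{N - W..<N}\<close>.  Subtraction truncates: if \<open>N < W\<close>, the window is the whole stream.
\<close>

definition window_volume :: "nat \<Rightarrow> ('a \<times> nat) list \<Rightarrow> 'a \<Rightarrow> nat" where
  "window_volume W ps x =
    (\<Sum>i \<in> {i \<in> {length ps - W..<length ps}. fst (ps ! i) = x}. snd (ps ! i))"


subsection \<open>FAST\<close>

record 'a fast =
  ids :: "'a set"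
  cnt :: "'a \<Rightarrow> nat"
  rmd :: "'a \<Rightarrow> nat"

definition fast_init :: "'a fast" where
  "fast_init = \<lparr>ids = {}, cnt = (\<lambda>_. 0), rmd = (\<lambda>_. 0)\<rparr>"

definition fast_step :: "nat \<Rightarrow> real \<Rightarrow> nat" where
  "fast_step M \<phi> = nat \<lfloor>real M * \<phi> / 2 + 1\<rfloor>"

definition fast_capacity :: "real \<Rightarrow> real \<Rightarrow> nat" where
  "fast_capacity \<delta> \<phi> = nat \<lceil>(1 + \<phi>) / \<delta>\<rceil>"

definition fast_query :: "nat \<Rightarrow> real \<Rightarrow> real \<Rightarrow> 'a fast \<Rightarrow> 'a \<Rightarrow> nat" where
  "fast_query M \<delta> \<phi> y x =
    (let s = fast_step M \<phi> in
     if x \<in> ids y \<or> card (ids y) < fast_capacity \<delta> \<phi>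
     then rmd y x + s * cnt y x
     else s - 1 + s * Min (cnt y ` ids y))"

text \<open>
  Adding a packet is a relation between the old and the new state, because the evicted id is an
  arbitrary minimiser of the counters.
\<close>

inductive fast_add ::
  "nat \<Rightarrow> real \<Rightarrow> real \<Rightarrow> 'a \<Rightarrow> nat \<Rightarrow> 'a fast \<Rightarrow> 'a fast \<Rightarrow> bool"
  for M :: nat and \<delta> \<phi> :: real and x :: 'a and w :: nat and y :: "'a fast" where
  update:
    "\<lbrakk>x \<in> ids y \<or> card (ids y) < fast_capacity \<delta> \<phi>; s = fast_step M \<phi>\<rbrakk> \<Longrightarrow>
     fast_add M \<delta> \<phi> x w y
       \<lparr>ids = insert x (ids y),
        cnt = (cnt y)(x := cnt y x + (rmd y x + w) div s),
        rmd = (rmd y)(x := (rmd y x + w) mod s)\<rparr>"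
| evict:
    "\<lbrakk>x \<notin> ids y; \<not> card (ids y) < fast_capacity \<delta> \<phi>; s = fast_step M \<phi>;
      is_arg_min (cnt y) (\<lambda>z. z \<in> ids y) m\<rbrakk> \<Longrightarrow>
     fast_add M \<delta> \<phi> x w y
       \<lparr>ids = insert x (ids y - {m}),
        cnt = (cnt y)(x := cnt y m + (s - 1 + w) div s),
        rmd = (rmd y)(x := (s - 1 + w) mod s)\<rparr>"


subsection \<open>WFAST\<close>

text \<open>
  \<open>queues\<close> lists the block queues from the newest block (head) to the oldest one (last element).
  Each block queue lists its ids in order of arrival: ids are pushed at the end and popped at the
  front.
\<close>

record 'a wfast =
  sketch :: "'a fast"
  offset :: nat
  queues :: "'a list list"
  table :: "'a \<Rightarrow> int option"

definition wfast_blocks :: "real \<Rightarrow> nat" where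
  "wfast_blocks \<epsilon> = nat \<lceil>4 / \<epsilon>\<rceil>"

text \<open>
  The divisions by the number of blocks below, in \<open>wfast_unit\<close> and \<open>wfast_advance\<close>, are exact
  whenever the number of blocks divides \<open>W\<close>, which WFAST assumes.
\<close>

definition wfast_unit :: "nat \<Rightarrow> nat \<Rightarrow> real \<Rightarrow> nat" where
  "wfast_unit W M \<epsilon> = M * W div wfast_blocks \<epsilon>"

definition wfast_init :: "real \<Rightarrow> 'a wfast" where
  "wfast_init \<epsilon> =
    \<lparr>sketch = fast_init, offset = 0, queues = replicate (wfast_blocks \<epsilon> + 1) [],
     table = Map.empty\<rparr>"

definition wfast_query :: "nat \<Rightarrow> real \<Rightarrow> real \<Rightarrow> 'a fast \<Rightarrow> 'a \<Rightarrow> nat" where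
  "wfast_query M \<epsilon> \<phi> = fast_query M (1 / real (wfast_blocks \<epsilon>)) \<phi>"

definition wfast_advance :: "nat \<Rightarrow> real \<Rightarrow> 'a wfast \<Rightarrow> 'a wfast" where
  "wfast_advance W \<epsilon> st =
    (let p = (offset st + 1) mod W in
     st\<lparr>offset := p,
        sketch := (if p = 0 then fast_init else sketch st),
        queues := (if p mod (W div wfast_blocks \<epsilon>) = 0 then [] # butlast (queues st)
                   else queues st)\<rparr>)"

text \<open>
  An absent entry is left unchanged.  This only makes the function total: every queued id has an
  entry in the table.
\<close>

definition table_decrease :: "'a \<Rightarrow> ('a \<Rightarrow> int option) \<Rightarrow> ('a \<Rightarrow> int option)" where
  "table_decrease z B =
    (case B z of None \<Rightarrow> B | Some n \<Rightarrow> if n - 1 = 0 then B(z := None) else B(z \<mapsto> n - 1))"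

definition table_increase :: "'a \<Rightarrow> ('a \<Rightarrow> int option) \<Rightarrow> ('a \<Rightarrow> int option)" where
  "table_increase x B = (case B x of None \<Rightarrow> B(x \<mapsto> 1) | Some n \<Rightarrow> B(x \<mapsto> n + 1))"

definition wfast_expire :: "'a wfast \<Rightarrow> 'a wfast" where
  "wfast_expire st =
    (case last (queues st) of
       [] \<Rightarrow> st
     | z # zs \<Rightarrow> st\<lparr>queues := butlast (queues st) @ [zs], table := table_decrease z (table st)\<rparr>)"

definition wfast_push :: "'a \<Rightarrow> 'a wfast \<Rightarrow> 'a wfast" where
  "wfast_push x st =
    st\<lparr>queues := (hd (queues st) @ [x]) # tl (queues st), table := table_increase x (table st)\<rparr>"

inductive wfast_add ::
  "nat \<Rightarrow> nat \<Rightarrow> real \<Rightarrow> real \<Rightarrow> 'a \<Rightarrow> nat \<Rightarrow> 'a wfast \<Rightarrow> 'a wfast \<Rightarrow> bool"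
  for W M :: nat and \<epsilon> \<phi> :: real and x :: 'a and w :: nat and st :: "'a wfast" where
  "\<lbrakk>st' = wfast_expire (wfast_advance W \<epsilon> st);
    fast_add M (1 / real (wfast_blocks \<epsilon>)) \<phi> x w (sketch st') y;
    T = wfast_unit W M \<epsilon>;
    overflow \<longleftrightarrow> wfast_query M \<epsilon> \<phi> y x div T > wfast_query M \<epsilon> \<phi> (sketch st') x div T\<rbrakk> \<Longrightarrow>
   wfast_add W M \<epsilon> \<phi> x w st
     (if overflow then wfast_push x (st'\<lparr>sketch := y\<rparr>) else st'\<lparr>sketch := y\<rparr>)"

text \<open>
  \<open>wfast_run W M \<epsilon> \<phi> ps st\<close>: processing the stream \<open>ps\<close>, first packet first, from the initial state
  can lead to the state \<open>st\<close>.
\<close>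

inductive wfast_run ::
  "nat \<Rightarrow> nat \<Rightarrow> real \<Rightarrow> real \<Rightarrow> ('a \<times> nat) list \<Rightarrow> 'a wfast \<Rightarrow> bool"
  for W M :: nat and \<epsilon> \<phi> :: real where
  empty: "wfast_run W M \<epsilon> \<phi> [] (wfast_init \<epsilon>)"
| snoc: "\<lbrakk>wfast_run W M \<epsilon> \<phi> ps st; wfast_add W M \<epsilon> \<phi> x w st st'\<rbrakk> \<Longrightarrow>
         wfast_run W M \<epsilon> \<phi> (ps @ [(x, w)]) st'"

definition win_query :: "nat \<Rightarrow> nat \<Rightarrow> real \<Rightarrow> real \<Rightarrow> 'a wfast \<Rightarrow> 'a \<Rightarrow> int" where
  "win_query W M \<epsilon> \<phi> st x =
    (let T = wfast_unit W M \<epsilon>; q = wfast_query M \<epsilon> \<phi> (sketch st) x in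
     case table st x of
       Some n \<Rightarrow> int T * (n + 2) + int (q mod T)
     | None \<Rightarrow> 2 * int T + int q)"


subsection \<open>Every stream can be processed\<close>

lemma fast_add_exists:
  assumes "finite (ids y)" and "\<delta> > 0" and "\<phi> \<ge> 0"
  shows "\<exists>y'. fast_add M \<delta> \<phi> x w y y' \<and> finite (ids y')"
proof (cases "x \<in> ids y \<or> card (ids y) < fast_capacity \<delta> \<phi>")
  case True
  from fast_add.update[OF this refl, of M w] assms(1) show ?thesis
    by (metis fast.select_convs(1) finite_insert)
next
  case False
  have "fast_capacity \<delta> \<phi> > 0"
    using assms by (simp add: fast_capacity_def add_pos_nonneg)
  with False have "ids y \<noteq> {}" by auto
  with assms(1) obtain m where "is_arg_min (cnt y) (\<lambda>z. z \<in> ids y) m"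
    using ex_is_arg_min_if_finite by metis
  from fast_add.evict[OF _ _ refl this, of x \<delta> \<phi> M w] False assms(1) show ?thesis
    by (metis fast.select_convs(1) finite_insert finite_Diff)
qed

lemma wfast_run_exists:
  fixes ps :: "('a \<times> nat) list"
  assumes "\<epsilon> > 0" and "\<phi> \<ge> 0"
  shows "\<exists>st. wfast_run W M \<epsilon> \<phi> ps st"
proof -
  have k: "1 / real (wfast_blocks \<epsilon>) > 0"
    using assms(1) by (simp add: wfast_blocks_def)
  have "\<exists>st. wfast_run W M \<epsilon> \<phi> ps st \<and> finite (ids (sketch st))"
  proof (induction ps rule: rev_induct)
    case Nil
    have "finite (ids (sketch (wfast_init \<epsilon> :: 'a wfast)))"
      by (simp add: wfast_init_def fast_init_def)
    with wfast_run.empty show ?case by blast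
  next
    case (snoc p ps)
    then obtain st where st: "wfast_run W M \<epsilon> \<phi> ps st" "finite (ids (sketch st))"
      by blast
    obtain x w where p: "p = (x, w)" by force
    let ?st' = "wfast_expire (wfast_advance W \<epsilon> st)"
    have "finite (ids (sketch ?st'))"
      using st(2)
      by (simp add: wfast_expire_def wfast_advance_def fast_init_def Let_def split: list.split)
    from fast_add_exists[OF this k assms(2)] obtain y
      where y: "fast_add M (1 / real (wfast_blocks \<epsilon>)) \<phi> x w (sketch ?st') y" "finite (ids y)"
      by blast
    from wfast_run.snoc[OF st(1) wfast_add.intros[OF refl y(1) refl refl]] y(2) show ?case
      unfolding p by (intro exI conjI) (assumption, simp add: wfast_push_def)
  qed
  then show ?thesis by blast
qed

end

theory Submission
  imports Defs
begin

text \<open>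
  Write \<open>T = M W / k\<close>.  Adding a packet of weight \<open>w\<close> raises the FAST estimate of its own id by
  exactly \<open>w \<le> T\<close>, leaves the estimate of every other tracked id unchanged, and after \<open>n\<close> packets of
  a frame all untracked ids have an estimate of at most \<open>n M / k\<close>.  This is below \<open>T\<close> before the last
  packet of the frame, so an estimate never passes a multiple of \<open>T\<close> without being recorded as an
  overflow, except by reaching \<open>T\<close> itself at the very end of a frame.  Hence over any final segment
  of a frame the number of overflows of an id, times \<open>T\<close>, agrees with its volume up to \<open>T\<close>.

  One packet of the oldest queue is popped per step, so the remaining queues contain all overflows
  in the blocks after the oldest one, and only overflows inside the window.  The window consists of
  the end of the previous frame and the current frame; the estimate of the latter costs one more
  \<open>T\<close>, the part of the window in the oldest block another one.  The total error is at most
  \<open>4 T \<le> W M \<epsilon>\<close>.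
\<close>

section \<open>Estimates of FAST\<close>

text \<open>\<open>n\<close> bounds the number of packets since the last flush. Each adds at most
  \<open>M\<close> plus a rounding loss of \<open>s - 1\<close> to the sum. An evicted id keeps
  stale counters, so untracked counters are known to be zero only while there is room.\<close>

definition fast_inv :: "nat \<Rightarrow> real \<Rightarrow> real \<Rightarrow> nat \<Rightarrow> 'a fast \<Rightarrow> bool" where
  "fast_inv M \<delta> \<phi> n y \<longleftrightarrow>
    finite (ids y) \<and> card (ids y) \<le> fast_capacity \<delta> \<phi> \<and> card (ids y) \<le> n \<and>
    (\<forall>z. rmd y z < fast_step M \<phi>) \<and>
    (card (ids y) < fast_capacity \<delta> \<phi> \<longrightarrow> (\<forall>z. z \<notin> ids y \<longrightarrow> cnt y z = 0 \<and> rmd y z = 0)) \<and>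
    (\<Sum>z\<in>ids y. fast_step M \<phi> * cnt y z + rmd y z) \<le> n * (M + fast_step M \<phi> - 1)"

lemma fast_step_pos: "\<phi> \<ge> 0 \<Longrightarrow> fast_step M \<phi> > 0"
  by (simp add: fast_step_def le_floor_iff less_nat_zero_code)

lemma fast_step_le: "\<phi> \<ge> 0 \<Longrightarrow> real (fast_step M \<phi>) - 1 \<le> real M * \<phi> / 2"
proof -
  assume "\<phi> \<ge> 0"
  then have "\<lfloor>real M * \<phi> / 2 + 1\<rfloor> \<ge> 0" by simp
  moreover have "of_int \<lfloor>real M * \<phi> / 2 + 1\<rfloor> \<le> real M * \<phi> / 2 + 1" by linarith
  ultimately show ?thesis unfolding fast_step_def by simp
qed

lemma fast_capacity_ge: "(1 + \<phi>) / \<delta> \<le> real (fast_capacity \<delta> \<phi>)"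
  unfolding fast_capacity_def by linarith

lemma fast_capacity_pos: "\<delta> > 0 \<Longrightarrow> \<phi> \<ge> 0 \<Longrightarrow> fast_capacity \<delta> \<phi> > 0"
  by (simp add: fast_capacity_def add_pos_nonneg)

lemma fast_inv_init: "\<phi> \<ge> 0 \<Longrightarrow> fast_inv M \<delta> \<phi> 0 fast_init"
  by (simp add: fast_inv_def fast_init_def fast_step_pos)

lemma fast_inv_mono: "fast_inv M \<delta> \<phi> n y \<Longrightarrow> n \<le> n' \<Longrightarrow> fast_inv M \<delta> \<phi> n' y"
  unfolding fast_inv_def by (meson le_trans mult_le_mono1)

text \<open>An update raises the sum of the tracked estimates by \<open>w\<close>. An eviction drops
  the estimate of \<open>m\<close>, at least \<open>s * cnt y m\<close>, and brings in
  \<open>s * cnt y m + s - 1 + w\<close>.\<close>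

lemma fast_inv_add:
  assumes inv: "fast_inv M \<delta> \<phi> n y" and add: "fast_add M \<delta> \<phi> x w y y'"
    and "w \<le> M" and "\<phi> \<ge> 0" and "\<delta> > 0"
  shows "fast_inv M \<delta> \<phi> (Suc n) y'"
  using add
proof cases
  case (update s)
  have s: "s > 0" using update fast_step_pos assms(4) by simp
  let ?f = "\<lambda>z. s * cnt y z + rmd y z" and ?f' = "\<lambda>z. s * cnt y' z + rmd y' z"
  have fin: "finite (ids y)" using inv by (simp add: fast_inv_def)
  have fx: "?f' x = ?f x + w"
    using update by (simp add: algebra_simps)
  have eq: "sum ?f' (ids y - {x}) = sum ?f (ids y - {x})"
    by (rule sum.cong) (auto simp: update)
  have fx0: "x \<notin> ids y \<Longrightarrow> ?f x = 0"
    using inv update by (auto simp: fast_inv_def)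
  have "sum ?f' (ids y') = ?f' x + sum ?f' (ids y - {x})"
    using fin by (simp add: update sum.insert_remove)
  also have "\<dots> = w + (?f x + sum ?f (ids y - {x}))" by (simp only: fx eq)
  also have "?f x + sum ?f (ids y - {x}) = sum ?f (ids y)"
    using fin fx0 by (cases "x \<in> ids y") (simp_all add: sum.remove)
  also have "\<dots> \<le> n * (M + s - 1)" using inv update by (simp add: fast_inv_def)
  also have "w \<le> M + s - 1" using s assms(3) by linarith
  finally have sum: "sum ?f' (ids y') \<le> Suc n * (M + s - 1)" by simp
  have "card (ids y') \<le> fast_capacity \<delta> \<phi>" "card (ids y') \<le> Suc n"
    using inv update fin by (auto simp: fast_inv_def card_insert_if)
  \<comment> \<open>If the new set is not full, neither was the old one, so the clause on zero
    counters carries over.\<close>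
  moreover have "card (ids y) \<le> card (ids y')"
    using fin by (simp add: update card_insert_le)
  ultimately show ?thesis
    using inv sum s fin unfolding fast_inv_def by (auto simp: update)
next
  case (evict s m)
  have s: "s > 0" using evict fast_step_pos assms(4) by simp
  have m: "m \<in> ids y" using evict by (simp add: is_arg_min_def)
  let ?f = "\<lambda>z. s * cnt y z + rmd y z" and ?f' = "\<lambda>z. s * cnt y' z + rmd y' z"
  have fin: "finite (ids y)" using inv by (simp add: fast_inv_def)
  have ids': "ids y' = insert x (ids y - {m})" by (simp add: evict)
  have xn: "x \<notin> ids y - {m}" using evict by simp
  have fx: "?f' x = s * cnt y m + (s - 1 + w)"
    by (simp add: evict distrib_left)
  have eq: "sum ?f' (ids y - {m}) = sum ?f (ids y - {m})"
    by (rule sum.cong) (use evict in auto)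
  have "sum ?f' (ids y') = ?f' x + sum ?f' (ids y - {m})"
    using fin xn by (simp add: ids')
  also have "\<dots> = s * cnt y m + (s - 1 + w) + sum ?f (ids y - {m})" by (simp only: fx eq)
  also have "\<dots> \<le> (M + s - 1) + (?f m + sum ?f (ids y - {m}))"
    using s assms(3) by simp
  also have "?f m + sum ?f (ids y - {m}) = sum ?f (ids y)"
    using fin m by (simp add: sum.remove)
  also have "\<dots> \<le> n * (M + s - 1)" using inv evict by (simp add: fast_inv_def)
  finally have sum: "sum ?f' (ids y') \<le> Suc n * (M + s - 1)" by simp
  have "card (ids y') = card (ids y)" "finite (ids y')"
    using fin xn m card_Suc_Diff1[OF fin m] by (simp_all add: ids')
  moreover have "\<forall>z. rmd y' z < s" using inv s by (simp add: evict fast_inv_def)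
  ultimately show ?thesis
    using inv sum evict(3) unfolding fast_inv_def evict(4)[symmetric] by simp
qed

text \<open>An eviction starts the new counters from \<open>s * cnt y m + s - 1\<close>, which is
  what the query returned for the untracked id; \<open>div\<close> and \<open>mod\<close> then split
  the total without loss.\<close>

lemma fast_query_add_same:
  assumes inv: "fast_inv M \<delta> \<phi> n y" and add: "fast_add M \<delta> \<phi> x w y y'"
    and "\<phi> \<ge> 0"
  shows "fast_query M \<delta> \<phi> y' x = fast_query M \<delta> \<phi> y x + w"
  using add
proof cases
  case (update s)
  then show ?thesis
    by (auto simp: fast_query_def Let_def algebra_simps)
next
  case (evict s m)
  have fin: "finite (ids y)" using inv by (simp add: fast_inv_def)
  have "Min (cnt y ` ids y) = cnt y m"
    using evict fin by (intro Min_eqI) (auto simp: is_arg_min_linorder)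
  then show ?thesis using evict
    by (simp add: fast_query_def Let_def distrib_left)
qed

text \<open>An id untracked afterwards had estimate 0 while there was room, or depends on a minimum
  that can only grow, or has just been evicted; in the last case the query replaces its remainder by
  the larger \<open>s - 1\<close>.\<close>

lemma fast_query_add_other:
  assumes inv: "fast_inv M \<delta> \<phi> n y" and add: "fast_add M \<delta> \<phi> x w y y'"
    and "\<phi> \<ge> 0" and "\<delta> > 0" and "z \<noteq> x"
  shows "fast_query M \<delta> \<phi> y z \<le> fast_query M \<delta> \<phi> y' z"
    and "z \<in> ids y' \<Longrightarrow> fast_query M \<delta> \<phi> y' z = fast_query M \<delta> \<phi> y z"
proof -
  have fin: "finite (ids y)" using inv by (simp add: fast_inv_def)
  have capp: "fast_capacity \<delta> \<phi> > 0" using fast_capacity_pos assms by blast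
  show same: "fast_query M \<delta> \<phi> y' z = fast_query M \<delta> \<phi> y z" if "z \<in> ids y'"
    using add that assms(5) by cases (auto simp: fast_query_def)
  show "fast_query M \<delta> \<phi> y z \<le> fast_query M \<delta> \<phi> y' z"
  proof (cases "z \<in> ids y'")
    case True
    then show ?thesis using same by simp
  next
    case z': False
    show ?thesis using add
    proof cases
      case (update s)
      have z: "z \<notin> ids y" using z' update by auto
      show ?thesis
      proof (cases "card (ids y) < fast_capacity \<delta> \<phi>")
        case True
        then have "fast_query M \<delta> \<phi> y z = 0"
          using z inv by (simp add: fast_query_def fast_inv_def)
        then show ?thesis by simp
      next
        case False
        then have x: "x \<in> ids y" using update by simp
        have ids': "ids y' = ids y" using x update by auto
        have "Min (cnt y ` ids y) \<le> Min (cnt y' ` ids y)"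
          using x fin by (intro Min.boundedI) (auto simp: update intro: le_trans[OF Min_le])
        then show ?thesis
          using False z by (simp add: fast_query_def Let_def ids')
      qed
    next
      case (evict s m)
      have s: "s > 0" using evict fast_step_pos assms(3) by simp
      have m: "m \<in> ids y" and le: "\<And>u. u \<in> ids y \<Longrightarrow> cnt y m \<le> cnt y u"
        using evict by (auto simp: is_arg_min_linorder)
      have ids': "ids y' = insert x (ids y - {m})" by (simp add: evict)
      have "card (ids y') = card (ids y)"
        using fin evict(2) m card_Suc_Diff1[OF fin m] by (simp add: ids')
      then have q': "fast_query M \<delta> \<phi> y' z = s - 1 + s * Min (cnt y' ` ids y')"
        using z' evict(3,4) by (simp add: fast_query_def Let_def)
      have min': "cnt y m \<le> Min (cnt y' ` ids y')"
        using fin by (intro Min.boundedI) (auto simp: evict le)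
      have "Min (cnt y ` ids y) = cnt y m"
        using fin m by (intro Min_eqI) (auto simp: le)
      moreover have "rmd y m \<le> s - 1" using inv s unfolding evict fast_inv_def
        by (metis One_nat_def Suc_leI Suc_pred le_simps(2))
      moreover have "z = m \<or> z \<notin> ids y" using z' by (auto simp: ids')
      ultimately have "fast_query M \<delta> \<phi> y z \<le> s - 1 + s * cnt y m"
        using evict m by (auto simp: fast_query_def Let_def)
      also have "\<dots> \<le> s - 1 + s * Min (cnt y' ` ids y')" using min' by simp
      finally show ?thesis by (simp add: q')
    qed
  qed
qed

text \<open>The minimum is at most the average over \<open>c\<close> counters. After multiplication
  by \<open>c\<close>, the rounding in the insertions and that in the query cost at most
  \<open>n * M * \<phi> / 2\<close> each; the capacity \<open>c\<close> absorbs the resulting factor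
  \<open>1 + \<phi>\<close>.\<close>

lemma fast_query_untracked_le:
  assumes inv: "fast_inv M \<delta> \<phi> n y" and "\<phi> \<ge> 0" and "\<delta> > 0" and "z \<notin> ids y"
  shows "real (fast_query M \<delta> \<phi> y z) \<le> real n * real M * \<delta>"
proof (cases "card (ids y) < fast_capacity \<delta> \<phi>")
  case True
  then show ?thesis using assms by (simp add: fast_query_def fast_inv_def)
next
  case False
  define c s m where "c = fast_capacity \<delta> \<phi>" and "s = fast_step M \<phi>"
    and "m = Min (cnt y ` ids y)"
  have c: "card (ids y) = c" "c \<le> n" "c > 0"
    using False inv assms by (auto simp: fast_inv_def c_def fast_capacity_pos)
  have s: "s > 0" using fast_step_pos assms(2) s_def by simp
  have fin: "finite (ids y)" using inv by (simp add: fast_inv_def)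
  have q: "fast_query M \<delta> \<phi> y z = s - 1 + s * m"
    using False assms by (simp add: fast_query_def Let_def s_def m_def)
  txt \<open>When all \<open>c\<close> counters are in use, at least \<open>c\<close> packets have arrived; this absorbs the
    rounding error \<open>s - 1\<close>.\<close>
  have "c * (s * m) = (\<Sum>u\<in>ids y. s * m)" by (simp add: c)
  also have "\<dots> \<le> (\<Sum>u\<in>ids y. s * cnt y u + rmd y u)"
    using fin by (intro sum_mono trans_le_add1 mult_le_mono2) (simp add: m_def)
  also have "\<dots> \<le> n * (M + s - 1)" using inv by (simp add: fast_inv_def s_def)
  finally have "real (c * (s * m)) \<le> real (n * (M + s - 1))" by linarith
  then have 1: "real c * (real s * real m) \<le> real n * (real M + (real s - 1))"
    using s by (simp add: of_nat_diff add_diff_eq)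
  have sb: "real s - 1 \<le> real M * \<phi> / 2" using fast_step_le assms(2) s_def by blast
  have 2: "real c * (real s - 1) \<le> real n * (real M * \<phi> / 2)"
    using sb c s by (intro mult_mono) auto
  have 3: "real n * (real M + (real s - 1)) \<le> real n * (real M + real M * \<phi> / 2)"
    using sb by (intro mult_left_mono) auto
  have "1 + \<phi> \<le> real c * \<delta>"
    using fast_capacity_ge[of \<phi> \<delta>] assms(3) by (simp add: c_def pos_divide_le_eq)
  then have 4: "(real n * real M) * (1 + \<phi>) \<le> (real n * real M) * (real c * \<delta>)"
    by (intro mult_left_mono) auto
  have "real c * (real s - 1 + real s * real m) \<le> (real n * real M) * (1 + \<phi>)"
    using 1 2 3 by (simp add: algebra_simps)
  also note 4
  also have "(real n * real M) * (real c * \<delta>) = real c * (real n * real M * \<delta>)" by simp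
  finally have "real s - 1 + real s * real m \<le> real n * real M * \<delta>" using c(3) by simp
  then show ?thesis using s by (simp add: q of_nat_diff)
qed

section \<open>Overflows within a frame\<close>

text \<open>
  The second alternative of \<open>add_packet\<close> is a packet of another id that leaves the id untracked: the
  estimate may then jump, but only below \<open>T\<close>, or to \<open>T\<close> with the last packet of the frame.
\<close>

locale overflow_frame =
  fixes T W l :: nat and q v :: "nat \<Rightarrow> nat" and E :: "nat \<Rightarrow> bool"
  assumes T_pos: "T > 0" and l_le: "l \<le> W" and q_0: "q 0 = 0"
    and v_le: "i < l \<Longrightarrow> v i \<le> T"
    and add_packet: "i < l \<Longrightarrow>
      q (Suc i) = q i + v i \<and> (E i \<longleftrightarrow> q i div T < q (Suc i) div T) \<or>
      v i = 0 \<and> \<not> E i \<and> q i \<le> q (Suc i) \<and> q (Suc i) \<le> T \<and> (Suc i < W \<longrightarrow> q (Suc i) < T)"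
begin

abbreviation volume :: "nat \<Rightarrow> nat \<Rightarrow> nat" where
  "volume a b \<equiv> (\<Sum>i\<in>{a..<b}. v i)"

definition overflows :: "nat \<Rightarrow> nat \<Rightarrow> nat" where
  "overflows a b = card {i \<in> {a..<b}. E i}"

lemma overflows_same [simp]: "overflows a a = 0"
  by (simp add: overflows_def)

lemma overflows_Suc:
  "a \<le> b \<Longrightarrow> overflows a (Suc b) = overflows a b + (if E b then 1 else 0)"
proof -
  assume "a \<le> b"
  then have "{i \<in> {a..<Suc b}. E i} = (if E b then insert b {i \<in> {a..<b}. E i} else {i \<in> {a..<b}. E i})"
    by (auto simp: less_Suc_eq)
  then show ?thesis by (simp add: overflows_def)
qed

lemma overflows_split: "a \<le> b \<Longrightarrow> overflows 0 b = overflows 0 a + overflows a b"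
  by (induction rule: dec_induct) (simp_all add: overflows_Suc)

lemma volume_le: "a \<le> b \<Longrightarrow> b \<le> l \<Longrightarrow> q a + volume a b \<le> q b"
proof (induction rule: dec_induct)
  case (step n)
  then show ?case using add_packet[of n] by auto
qed simp

text \<open>Every jump ends at \<open>T\<close> or below, so \<open>max T\<close> absorbs all jumps
  together.\<close>

lemma q_le: "a \<le> b \<Longrightarrow> b \<le> l \<Longrightarrow> q b \<le> max T (q a) + volume a b"
proof (induction rule: dec_induct)
  case (step n)
  then show ?case using add_packet[of n] by auto
qed simp

lemma div_add_le: "w \<le> T \<Longrightarrow> (n + w) div T \<le> n div T + 1"
proof -
  assume "w \<le> T"
  then have "(n + w) div T \<le> (n + T) div T" by (intro div_le_mono) simp
  also have "\<dots> = n div T + 1" using T_pos by simp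
  finally show ?thesis .
qed

text \<open>A packet weighs at most \<open>T\<close> and so crosses at most one multiple of
  \<open>T\<close>: one recorded overflow is enough.\<close>

lemma div_Suc_overflow:
  assumes "i < l" and "q (Suc i) = q i + v i" and "E i \<longleftrightarrow> q i div T < q (Suc i) div T"
  shows "q (Suc i) div T = q i div T + (if E i then 1 else 0)"
proof -
  have "q (Suc i) div T \<le> q i div T + 1"
    using div_add_le v_le assms by simp
  moreover have "q i div T \<le> q (Suc i) div T" using assms(2) by (simp add: div_le_mono)
  ultimately show ?thesis using assms(3) by auto
qed

text \<open>A jump before the end of the frame stays below \<open>T\<close>, where both quotients
  are 0. The bound \<open>b < W\<close> excludes the last jump, which may reach \<open>T\<close>
  unrecorded.\<close>

lemma div_eq_overflows: "b \<le> l \<Longrightarrow> b < W \<Longrightarrow> q b div T = overflows 0 b"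
proof (induction b)
  case 0
  then show ?case by (simp add: q_0)
next
  case (Suc b)
  then have IH: "q b div T = overflows 0 b" and "b < l" by simp_all
  from add_packet[OF this(2)] show ?case
  proof
    assume "q (Suc b) = q b + v b \<and> E b = (q b div T < q (Suc b) div T)"
    then show ?thesis using IH div_Suc_overflow[OF \<open>b < l\<close>] by (simp add: overflows_Suc)
  next
    assume A: "v b = 0 \<and> \<not> E b \<and> q b \<le> q (Suc b) \<and> q (Suc b) \<le> T \<and> (Suc b < W \<longrightarrow> q (Suc b) < T)"
    then have "q (Suc b) < T" "q b < T" using Suc by auto
    then show ?thesis using IH A by (simp add: overflows_Suc)
  qed
qed

lemma bounds_of_div:
  assumes "n div T = m"
  shows "T * m \<le> n" and "n < T * (m + 1)"
  using dividend_less_times_div[OF T_pos, of n] assms by auto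

text \<open>At the end of the frame the quotient may be off by the unrecorded jump to
  \<open>T\<close>; making the upper bound non-strict covers this case.\<close>

lemma overflows_bounds:
  assumes "b \<le> l"
  shows "T * overflows 0 b \<le> q b" and "q b \<le> T * (overflows 0 b + 1)"
proof -
  have "T * overflows 0 b \<le> q b \<and> q b \<le> T * (overflows 0 b + 1)"
  proof (cases "b < W \<or> b = 0")
    case True
    then have "q b div T = overflows 0 b" using div_eq_overflows assms q_0 by auto
    then show ?thesis using bounds_of_div less_imp_le by blast
  next
    case False
    then obtain c where c: "b = Suc c" "c < l" "c < W"
      using assms l_le by (cases b) auto
    have dc: "q c div T = overflows 0 c" using div_eq_overflows c by simp
    from add_packet[OF c(2)] show ?thesis
    proof
      assume "q (Suc c) = q c + v c \<and> E c = (q c div T < q (Suc c) div T)"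
      then have "q b div T = overflows 0 b"
        using dc div_Suc_overflow[OF c(2)] by (simp add: overflows_Suc c)
      then show ?thesis using bounds_of_div less_imp_le by blast
    next
      assume "v c = 0 \<and> \<not> E c \<and> q c \<le> q (Suc c) \<and> q (Suc c) \<le> T \<and> (Suc c < W \<longrightarrow> q (Suc c) < T)"
      then show ?thesis using bounds_of_div(1)[OF dc] by (simp add: overflows_Suc c)
    qed
  qed
  then show "T * overflows 0 b \<le> q b" "q b \<le> T * (overflows 0 b + 1)" by auto
qed

text \<open>In \<open>q_le\<close> the maximum is either \<open>T\<close> or \<open>q a\<close>, and
  \<open>q a\<close> exceeds \<open>T * overflows 0 a\<close> by less than \<open>T\<close>. Either
  way the loss is at most one \<open>T\<close>.\<close>

lemma overflows_le:
  assumes "a \<le> b" "b \<le> l"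
  shows "T * overflows a b \<le> volume a b + T"
proof (cases "a = b")
  case False
  then have a: "a < W" "a \<le> l" using assms l_le by auto
  have "q a < T * (overflows 0 a + 1)"
    using bounds_of_div(2) div_eq_overflows[OF a(2,1)] by blast
  moreover have "T * overflows 0 b = T * overflows 0 a + T * overflows a b"
    using overflows_split[OF assms(1)] by (simp add: distrib_left)
  ultimately show ?thesis
    using overflows_bounds(1)[OF assms(2)] q_le[OF assms] by (simp add: max_def split: if_splits)
qed simp

lemma volume_le_overflows:
  assumes "a \<le> b" "b \<le> l"
  shows "volume a b \<le> T * (overflows a b + 1)"
proof -
  have "T * overflows 0 b = T * overflows 0 a + T * overflows a b"
    using overflows_split[OF assms(1)] by (simp add: distrib_left)
  then show ?thesis
    using overflows_bounds(2)[OF assms(2)] overflows_bounds(1)[of a] volume_le[OF assms] assms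
    by simp
qed

end

section \<open>The block queues\<close>

text \<open>\<open>ev i\<close> is the id that overflows at time \<open>i\<close>, if any. One event
  per time means that a block of length \<open>L\<close> queues at most \<open>L\<close> ids, so one
  pop per packet empties a queue within one block.\<close>

definition block_queue :: "(nat \<Rightarrow> 'a option) \<Rightarrow> nat \<Rightarrow> nat \<Rightarrow> 'a list" where
  "block_queue ev L b = List.map_filter ev [b * L..<b * L + L]"

text \<open>
  The \<open>n mod L + 1\<close> packets of the current block have popped that many ids from the oldest queue.
\<close>

definition queue_state :: "(nat \<Rightarrow> 'a option) \<Rightarrow> nat \<Rightarrow> nat \<Rightarrow> nat \<Rightarrow> 'a list list" where
  "queue_state ev L k n =
    map (\<lambda>b. block_queue ev L (n div L - b)) [0..<k] @
    [drop (n mod L + 1) (block_queue ev L (n div L - k))]"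

definition expire_queues :: "'a list list \<Rightarrow> 'a list list" where
  "expire_queues qs = (case last qs of [] \<Rightarrow> qs | z # zs \<Rightarrow> butlast qs @ [zs])"

lemma expire_queues_snoc: "expire_queues (qs @ [r]) = qs @ [tl r]"
  by (simp add: expire_queues_def split: list.split)

lemma length_map_filter_le: "length (List.map_filter f xs) \<le> length xs"
  by (induction xs) (auto simp: List.map_filter_simps split: option.split)

lemma map_filter_append: "List.map_filter f (xs @ ys) = List.map_filter f xs @ List.map_filter f ys"
  by (simp add: List.map_filter_def)

lemma upt_append': "a \<le> b \<Longrightarrow> b \<le> c \<Longrightarrow> [a..<c] = [a..<b] @ [b..<c]"
  using upt_add_eq_append[of a b "c - b"] by simp

lemma map_filter_cong_set:
  "(\<And>x. x \<in> set xs \<Longrightarrow> f x = g x) \<Longrightarrow> List.map_filter f xs = List.map_filter g xs"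
  by (induction xs) (auto simp: List.map_filter_simps split: option.split)

lemma map_filter_None: "(\<And>x. x \<in> set xs \<Longrightarrow> f x = None) \<Longrightarrow> List.map_filter f xs = []"
  by (induction xs) (auto simp: List.map_filter_simps)

lemma length_block_queue_le: "length (block_queue ev L b) \<le> L"
  unfolding block_queue_def using length_map_filter_le[of ev "[b * L..<b * L + L]"] by simp

text \<open>By the last step of a block the oldest queue has undergone \<open>L\<close> pops.
  Discarding it therefore loses no id that the table still counts.\<close>

lemma last_queue_state_boundary:
  "L dvd Suc n \<Longrightarrow> L > 0 \<Longrightarrow> last (queue_state ev L k n) = []"
  using length_block_queue_le[of ev L "n div L - k"]
  by (simp add: queue_state_def) (metis Suc_le_lessD dvd_imp_mod_0 le_trans mod_Suc not_less_eq_eq nat.distinct(1) order_refl)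

text \<open>At a block boundary the next queue becomes the oldest and loses its first id in the same
  step, which is why \<open>queue_state\<close> drops \<open>n mod L + 1\<close> ids and not
  \<open>n mod L\<close>.\<close>

lemma queue_state_Suc:
  assumes none: "\<And>i. i > n \<Longrightarrow> ev i = None" and "L > 0" and "k > 0" and "k \<le> n div L"
  shows "expire_queues (if L dvd Suc n then [] # butlast (queue_state ev L k n) else queue_state ev L k n)
     = queue_state ev L k (Suc n)"
proof (cases "L dvd Suc n")
  case True
  then have d: "Suc n div L = Suc (n div L)" "Suc n mod L = 0"
    by (simp_all add: div_Suc dvd_eq_mod_eq_0)
  obtain k' where k': "k = Suc k'" using assms(3) by (cases k) auto
  have "Suc n = Suc (n div L) * L" using d by (metis mult_div_mod_eq mult.commute add_0_right)
  then have new: "block_queue ev L (Suc (n div L)) = []"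
    unfolding block_queue_def by (intro map_filter_None none) auto
  have e1: "map (\<lambda>b. block_queue ev L (Suc (n div L) - b)) [0..<Suc k']
      = [] # map (\<lambda>b. block_queue ev L (n div L - b)) [0..<k']"
    using new by (simp add: map_upt_Suc del: upt_Suc)
  have e2: "Suc (n div L) - Suc k' = n div L - k'" by simp
  have "[] # butlast (queue_state ev L k n) =
     ([] # map (\<lambda>b. block_queue ev L (n div L - b)) [0..<k']) @ [block_queue ev L (n div L - k')]"
    by (simp add: queue_state_def k' butlast_append)
  then show ?thesis
    using True by (simp only: if_True expire_queues_snoc)
      (simp add: queue_state_def k' d e1 drop_Suc del: upt_Suc)
next
  case False
  then have d: "Suc n div L = n div L" "Suc n mod L = Suc (n mod L)"
    by (simp_all add: div_Suc mod_Suc dvd_eq_mod_eq_0 split: if_splits)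
  show ?thesis
    using False by (simp add: queue_state_def expire_queues_snoc d tl_drop[symmetric] drop_Suc)
qed

text \<open>Time \<open>n\<close> lies in the newest block and no later event exists, so the new
  event is the last one of the head queue.\<close>

lemma queue_state_push:
  assumes none: "\<And>i. i \<ge> n \<Longrightarrow> ev i = None" and "L > 0" and "k > 0" and "k \<le> n div L"
  shows "queue_state (ev(n := Some z)) L k n =
    (hd (queue_state ev L k n) @ [z]) # tl (queue_state ev L k n)"
proof -
  have n: "n = n div L * L + n mod L" "n mod L < L" using assms(2) by simp_all
  have old: "block_queue (ev(n := Some z)) L b = block_queue ev L b" if "b < n div L" for b
  proof -
    have "b * L + L \<le> n div L * L" using that by (metis Suc_leI mult_Suc mult_le_mono1 add.commute)
    also have "\<dots> \<le> n" by simp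
    finally show ?thesis unfolding block_queue_def by (intro map_filter_cong_set) auto
  qed
  define b where "b = n div L * L"
  have b: "b \<le> n" "n < b + L" using n unfolding b_def by linarith+
  then have upt: "[b..<b + L] = [b..<n] @ [n] @ [Suc n..<b + L]"
    using upt_append'[of b n "b + L"] upt_conv_Cons[of n "b + L"] by simp
  have "block_queue ev L (n div L) = List.map_filter ev [b..<n] @ [] @ []"
    unfolding block_queue_def b_def[symmetric] upt map_filter_append
    by (intro arg_cong2[where f = append] refl map_filter_None none) auto
  moreover have "block_queue (ev(n := Some z)) L (n div L) = List.map_filter ev [b..<n] @ [z] @ []"
    unfolding block_queue_def b_def[symmetric] upt map_filter_append
    by (intro arg_cong2[where f = append] map_filter_None map_filter_cong_set)
      (auto simp: none List.map_filter_simps)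
  ultimately have new: "block_queue (ev(n := Some z)) L (n div L) = block_queue ev L (n div L) @ [z]"
    by simp
  obtain k' where k': "k = Suc k'" using assms(3) by (cases k) auto
  show ?thesis
    unfolding queue_state_def k' map_upt_Suc
    using old assms(4) new by (auto simp: k' map_upt_Suc simp del: upt_Suc)
qed

section \<open>Occurrences of an id in the queues\<close>

lemma count_list_map_filter_upt:
  "count_list (List.map_filter ev [a..<b]) x = card {i \<in> {a..<b}. ev i = Some x}"
proof (induction b)
  case (Suc b)
  show ?case
  proof (cases "a \<le> b")
    case True
    then have "{i \<in> {a..<Suc b}. ev i = Some x} =
      (if ev b = Some x then insert b {i \<in> {a..<b}. ev i = Some x} else {i \<in> {a..<b}. ev i = Some x})"
      by (auto simp: less_Suc_eq)
    then show ?thesis using True Suc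
      by (simp add: map_filter_append List.map_filter_simps split: option.split)
  qed (simp add: List.map_filter_simps)
qed (simp add: List.map_filter_simps)

lemma count_list_blocks:
  "k \<le> Suc j \<Longrightarrow> count_list (concat (map (\<lambda>b. block_queue ev L (j - b)) [0..<k])) x
    = card {i \<in> {(Suc j - k) * L..<Suc j * L}. ev i = Some x}"
proof (induction k)
  case (Suc k)
  have *: "Suc j - k = Suc (j - k)" using Suc by simp
  have le: "i < L + j * L" if "i < (j - k) * L + L" for i
    using that mult_le_mono1[of "j - k" j L] by linarith
  have "{i \<in> {(j - k) * L..<Suc j * L}. ev i = Some x}
     = {i \<in> {Suc (j - k) * L..<Suc j * L}. ev i = Some x} \<union> {i \<in> {(j - k) * L..<(j - k) * L + L}. ev i = Some x}"
    using le by (auto simp del: mult_le_cancel2)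
  moreover have "card \<dots> = card {i \<in> {Suc (j - k) * L..<Suc j * L}. ev i = Some x}
     + card {i \<in> {(j - k) * L..<(j - k) * L + L}. ev i = Some x}"
    by (intro card_Un_disjoint) auto
  ultimately show ?case
    using Suc by (simp add: * block_queue_def count_list_map_filter_upt)
qed simp

lemma count_list_drop_le: "count_list (drop i xs) x \<le> count_list xs x"
  by (metis append_take_drop_id count_list_append le_add2)

text \<open>The \<open>k\<close> newest queues are complete, which gives the lower bound. The first
  \<open>n mod L + 1\<close> times of the oldest block produced at most as many ids as have been
  popped, so whatever is left there arrived later, within the last \<open>k * L\<close>
  times.\<close>

lemma count_queue_state:
  assumes none: "\<And>i. i > n \<Longrightarrow> ev i = None" and "L > 0" and "k > 0" and "k \<le> n div L"
  shows "card {i \<in> {(Suc (n div L) - k) * L..<Suc n}. ev i = Some x}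
       \<le> count_list (concat (queue_state ev L k n)) x"
    and "count_list (concat (queue_state ev L k n)) x
       \<le> card {i \<in> {Suc n - k * L..<Suc n}. ev i = Some x}"
proof -
  define j p where "j = n div L" and "p = n mod L"
  have n: "n = j * L + p" "p < L" using assms(2) by (simp_all add: j_def p_def)
  have kj: "k \<le> j" using assms by (simp add: j_def)
  let ?A = "{i \<in> {(Suc j - k) * L..<Suc n}. ev i = Some x}"
  \<comment> \<open>The current block may be extended to its full length, since no event lies after
    \<open>n\<close>.\<close>
  have "{i \<in> {(Suc j - k) * L..<Suc j * L}. ev i = Some x} = ?A"
  proof -
    have "i < Suc j * L \<longleftrightarrow> i < Suc n" if "ev i = Some x" for i
    proof -
      have "i \<le> n" using none[of i] that by (cases "n < i") auto
      then show ?thesis using n by simp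
    qed
    then show ?thesis by auto
  qed
  then have recent: "count_list (concat (map (\<lambda>b. block_queue ev L (j - b)) [0..<k])) x = card ?A"
    using count_list_blocks[of k j ev L x] kj by simp
  define a where "a = (j - k) * L"
  have ak: "a + k * L = j * L" "(Suc j - k) * L = a + L"
    using kj unfolding a_def by (simp_all add: Suc_diff_le flip: distrib_right)
  have "L \<le> k * L" using assms(3) by simp
  with ak have aL: "a + L \<le> j * L" by linarith
  have upt: "[a..<a + L] = [a..<a + p + 1] @ [a + p + 1..<a + L]"
    using n upt_append'[of a "a + p + 1" "a + L"] by simp
  define B where "B = {i \<in> {a + p + 1..<a + L}. ev i = Some x}"
  let ?l = "List.map_filter ev [a..<a + p + 1]"
  have "length ?l \<le> p + 1" using length_map_filter_le[of ev "[a..<a + p + 1]"] by simp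
  then have "drop (p + 1) (block_queue ev L (j - k)) =
     drop (p + 1 - length ?l) (List.map_filter ev [a + p + 1..<a + L])"
    unfolding block_queue_def a_def[symmetric] upt map_filter_append by simp
  then have old: "count_list (drop (p + 1) (block_queue ev L (j - k))) x \<le> card B"
    unfolding B_def count_list_map_filter_upt[symmetric] by (simp add: count_list_drop_le)
  have split: "{i \<in> {Suc n - k * L..<Suc n}. ev i = Some x} = B \<union> ?A"
    using n ak aL unfolding B_def by auto
  have "card (B \<union> ?A) = card B + card ?A"
    using ak unfolding B_def by (intro card_Un_disjoint) auto
  then show "card {i \<in> {(Suc (n div L) - k) * L..<Suc n}. ev i = Some x}
       \<le> count_list (concat (queue_state ev L k n)) x"
    and "count_list (concat (queue_state ev L k n)) x
       \<le> card {i \<in> {Suc n - k * L..<Suc n}. ev i = Some x}"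
    using recent old unfolding split
    by (simp_all add: queue_state_def flip: j_def p_def)
qed

section \<open>Histories of WFAST\<close>

text \<open>The table is a function of the queues, so the invariant of a run only has to describe
  the queues.\<close>

definition table_of :: "'a list list \<Rightarrow> 'a \<Rightarrow> int option" where
  "table_of qs z = (let c = count_list (concat qs) z in if c = 0 then None else Some (int c))"

lemma table_decrease_table_of: "table_decrease z (table_of (qs @ [z # zs])) = table_of (qs @ [zs])"
  by (rule ext) (auto simp: table_decrease_def table_of_def Let_def)

lemma table_increase_table_of: "table_increase z (table_of (q # qs)) = table_of ((q @ [z]) # qs)"
  by (rule ext) (auto simp: table_increase_def table_of_def Let_def)

lemma table_of_shift: "qs \<noteq> [] \<Longrightarrow> last qs = [] \<Longrightarrow> table_of ([] # butlast qs) = table_of qs"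
  by (cases qs rule: rev_cases) (auto simp: table_of_def fun_eq_iff)

lemma wfast_expire_eq:
  assumes "queues st \<noteq> []" and "table st = table_of (queues st)"
  shows "wfast_expire st = st\<lparr>queues := expire_queues (queues st), table := table_of (expire_queues (queues st))\<rparr>"
proof (cases "last (queues st)")
  case Nil
  then show ?thesis using assms(2)[symmetric] by (simp add: wfast_expire_def expire_queues_def)
next
  case (Cons z zs)
  have "queues st = butlast (queues st) @ [z # zs]"
    using assms(1) Cons by (metis append_butlast_last_id)
  then have "table_decrease z (table st) = table_of (butlast (queues st) @ [zs])"
    using assms(2) table_decrease_table_of by metis
  then show ?thesis using Cons by (simp add: wfast_expire_def expire_queues_def)
qed

text \<open>
  Time is shifted by \<open>W\<close>: packet \<open>i\<close> (counted from 1, as the offset does) arrives at time \<open>W + i\<close>, and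
  times up to \<open>W\<close> carry no packet.  The shift keeps frames and blocks aligned, makes the first frame
  as long as the others, and ensures that every window and every oldest block start at a
  non-negative time.
\<close>

definition padded :: "nat \<Rightarrow> ('a \<times> nat) list \<Rightarrow> nat \<Rightarrow> ('a \<times> nat) option" where
  "padded W ps i = (if W < i \<and> i \<le> W + length ps then Some (ps ! (i - W - 1)) else None)"

lemma padded_in_set: "padded W ps i = Some p \<Longrightarrow> p \<in> set ps"
  by (auto simp: padded_def split: if_splits intro!: nth_mem)

definition packet_weight :: "'a \<Rightarrow> ('a \<times> nat) option \<Rightarrow> nat" where
  "packet_weight x p = (case p of None \<Rightarrow> 0 | Some (d, w) \<Rightarrow> if d = x then w else 0)"

definition sketch_step ::
  "nat \<Rightarrow> real \<Rightarrow> real \<Rightarrow> nat \<Rightarrow> ('a \<times> nat) option \<Rightarrow> 'a fast \<Rightarrow> 'a fast \<Rightarrow> 'a option \<Rightarrow> bool" where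
  "sketch_step M \<delta> \<phi> T p y y' e =
    (case p of
       None \<Rightarrow> y' = y \<and> e = None
     | Some (d, w) \<Rightarrow> fast_add M \<delta> \<phi> d w y y' \<and>
         e = (if fast_query M \<delta> \<phi> y' d div T > fast_query M \<delta> \<phi> y d div T then Some d else None))"

definition sketch_before :: "nat \<Rightarrow> (nat \<Rightarrow> 'a fast) \<Rightarrow> nat \<Rightarrow> 'a fast" where
  "sketch_before W Y i = (if i mod W = 0 then fast_init else Y (i - 1))"

text \<open>A final state forgets earlier sketches and popped overflows. \<open>Y\<close> and
  \<open>ev\<close> record the sketch after each time and the overflow at each time, so that the
  previous frame can still be analysed.\<close>

definition wfast_history ::
  "nat \<Rightarrow> nat \<Rightarrow> real \<Rightarrow> real \<Rightarrow> ('a \<times> nat) list \<Rightarrow> (nat \<Rightarrow> 'a fast) \<Rightarrow> (nat \<Rightarrow> 'a option) \<Rightarrow> bool" where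
  "wfast_history W M \<epsilon> \<phi> ps Y ev \<longleftrightarrow>
    (\<forall>i \<le> W + length ps.
      sketch_step M (1 / real (wfast_blocks \<epsilon>)) \<phi> (wfast_unit W M \<epsilon>)
        (padded W ps i) (sketch_before W Y i) (Y i) (ev i)) \<and>
    (\<forall>i > W + length ps. ev i = None)"

lemma wfast_run_history:
  assumes "wfast_run W M \<epsilon> \<phi> ps st" and "W > 0" and k: "wfast_blocks \<epsilon> > 0" and "wfast_blocks \<epsilon> dvd W"
  defines "k \<equiv> wfast_blocks \<epsilon>" and "L \<equiv> W div wfast_blocks \<epsilon>"
  shows "\<exists>Y ev. wfast_history W M \<epsilon> \<phi> ps Y ev \<and> sketch st = Y (W + length ps) \<and>
    offset st = (W + length ps) mod W \<and> queues st = queue_state ev L k (W + length ps) \<and>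
    table st = table_of (queues st)"
  using assms(1)
proof induction
  case empty
  have "block_queue (\<lambda>_. None :: 'a option) L b = []" for b
    by (simp add: block_queue_def map_filter_None)
  then have "queues (wfast_init \<epsilon>) = queue_state (\<lambda>_. None :: 'a option) L k (W + length [])"
    by (simp add: wfast_init_def queue_state_def k_def map_replicate_const replicate_append_same)
  moreover have "wfast_history W M \<epsilon> \<phi> [] (\<lambda>_. fast_init :: 'a fast) (\<lambda>_. None)"
    by (simp add: wfast_history_def sketch_step_def padded_def sketch_before_def)
  moreover have "table_of (queues (wfast_init \<epsilon>)) = (Map.empty :: 'a \<Rightarrow> int option)"
    by (simp add: wfast_init_def table_of_def fun_eq_iff)
  moreover have "sketch (wfast_init \<epsilon>) = (fast_init :: 'a fast)" "offset (wfast_init \<epsilon>) = 0"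
    "table (wfast_init \<epsilon>) = (Map.empty :: 'a \<Rightarrow> int option)"
    by (simp_all add: wfast_init_def)
  ultimately show ?case
    by (intro exI[of _ "\<lambda>_. fast_init"] exI[of _ "\<lambda>_. None"]) simp
next
  case (snoc ps st x w st')
  define n where "n = W + length ps"
  obtain Y ev where h: "wfast_history W M \<epsilon> \<phi> ps Y ev" and sk: "sketch st = Y n"
    and off: "offset st = n mod W" and qs: "queues st = queue_state ev L k n"
    and tab: "table st = table_of (queues st)"
    using snoc.IH unfolding n_def by blast
  have LW: "L * k = W" "L > 0" "k > 0"
    using assms by (auto simp: L_def k_def dvd_div_eq_0_iff)
  have none: "\<And>i. i > n \<Longrightarrow> ev i = None" using h by (auto simp: wfast_history_def n_def)
  have kn: "k \<le> n div L" using LW by (simp add: n_def less_eq_div_iff_mult_less_eq mult.commute)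
  have kn': "k \<le> Suc n div L" using kn by (meson div_le_mono le_SucI le_refl le_trans)
  define ad where "ad = wfast_advance W \<epsilon> st"
  have mod: "(n mod W + 1) mod W = Suc n mod W" by (simp add: mod_Suc_eq)
  \<comment> \<open>The algorithm detects blocks from its offset modulo \<open>W\<close>; as
    \<open>L\<close> divides \<open>W\<close>, these are the blocks of absolute time.\<close>
  have "Suc n mod W mod L = Suc n mod L" using LW(1) by (metis dvd_triv_left mod_mod_cancel)
  then have ad: "offset ad = Suc n mod W" "sketch ad = sketch_before W Y (Suc n)"
    "queues ad = (if L dvd Suc n then [] # butlast (queues st) else queues st)"
    "table ad = table st"
    using mod sk off by (simp_all add: ad_def wfast_advance_def Let_def sketch_before_def
        flip: L_def) (simp_all add: dvd_eq_mod_eq_0)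
  have qne: "queues st \<noteq> []" by (simp add: qs queue_state_def)
  have "table ad = table_of (queues ad)"
    using last_queue_state_boundary[of L n ev k] LW qne tab
    by (auto simp: ad(3,4) table_of_shift qs)
  moreover have "queues ad \<noteq> []" using qne ad(3) by auto
  moreover have "expire_queues (queues ad) = queue_state ev L k (Suc n)"
    unfolding ad(3) qs by (rule queue_state_Suc[OF none LW(2,3) kn])
  ultimately have ex: "wfast_expire ad =
      ad\<lparr>queues := queue_state ev L k (Suc n), table := table_of (queue_state ev L k (Suc n))\<rparr>"
    using wfast_expire_eq by metis
  from snoc.hyps(2) obtain y ovf where
    add: "fast_add M (1 / real k) \<phi> x w (sketch_before W Y (Suc n)) y"
    and ovf: "ovf \<longleftrightarrow> fast_query M (1 / real k) \<phi> y x div wfast_unit W M \<epsilon>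
        > fast_query M (1 / real k) \<phi> (sketch_before W Y (Suc n)) x div wfast_unit W M \<epsilon>"
    and st': "st' = (if ovf then wfast_push x ((wfast_expire ad)\<lparr>sketch := y\<rparr>)
        else (wfast_expire ad)\<lparr>sketch := y\<rparr>)"
  proof cases
    case (1 s' y T ovf)
    have "s' = wfast_expire ad" by (simp only: 1 ad_def)
    then show thesis using 1 that[of y ovf] by (simp add: ex ad wfast_query_def k_def)
  qed
  define Y' where "Y' = Y(Suc n := y)"
  define ev' where "ev' = ev(Suc n := if ovf then Some x else None)"
  have len: "W + length (ps @ [(x, w)]) = Suc n" by (simp add: n_def)
  have old: "padded W (ps @ [(x, w)]) i = padded W ps i" "sketch_before W Y' i = sketch_before W Y i"
    "Y' i = Y i" "ev' i = ev i" if "i \<le> n" for i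
    using that by (auto simp: padded_def n_def nth_append sketch_before_def Y'_def ev'_def)
  have new: "padded W (ps @ [(x, w)]) (Suc n) = Some (x, w)"
    "sketch_before W Y' (Suc n) = sketch_before W Y (Suc n)"
    by (auto simp: padded_def n_def nth_append sketch_before_def Y'_def)
  have "wfast_history W M \<epsilon> \<phi> (ps @ [(x, w)]) Y' ev'"
    unfolding wfast_history_def len
  proof (intro conjI allI impI)
    fix i assume i: "i \<le> Suc n"
    show "sketch_step M (1 / real (wfast_blocks \<epsilon>)) \<phi> (wfast_unit W M \<epsilon>)
        (padded W (ps @ [(x, w)]) i) (sketch_before W Y' i) (Y' i) (ev' i)"
    proof (cases "i = Suc n")
      case True
      then show ?thesis unfolding True new
        using add ovf by (simp add: sketch_step_def Y'_def ev'_def k_def)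
    next
      case False
      then have "i \<le> n" using i by simp
      then show ?thesis using h by (simp add: old wfast_history_def n_def)
    qed
  next
    fix i assume "i > Suc n"
    then show "ev' i = None" using none by (simp add: ev'_def)
  qed
  moreover have "queues st' = queue_state ev' L k (Suc n) \<and> table st' = table_of (queues st')"
  proof (cases ovf)
    case True
    have "queue_state ev L k (Suc n) \<noteq> []" by (simp add: queue_state_def)
    then have "table_increase x (table_of (queue_state ev L k (Suc n))) =
        table_of ((hd (queue_state ev L k (Suc n)) @ [x]) # tl (queue_state ev L k (Suc n)))"
      using table_increase_table_of by (metis list.collapse)
    moreover have "queue_state ev' L k (Suc n) =
        (hd (queue_state ev L k (Suc n)) @ [x]) # tl (queue_state ev L k (Suc n))"
      using True queue_state_push[OF none LW(2,3) kn'] by (simp add: ev'_def)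
    ultimately show ?thesis
      using True by (simp add: st' ex wfast_push_def)
  next
    case False
    have "ev' = ev" using False none[of "Suc n"] by (simp add: ev'_def fun_eq_iff)
    then show ?thesis using False by (simp add: st' ex)
  qed
  moreover have "sketch st' = Y' (Suc n)" "offset st' = Suc n mod W"
    using ad(1) by (simp_all add: st' ex Y'_def wfast_push_def)
  ultimately show ?case unfolding len by (intro exI[of _ Y'] exI[of _ ev'] conjI) simp_all
qed

section \<open>Frames of a history\<close>

text \<open>Only a packet of another id that leaves \<open>x\<close> untracked is a jump. The
  estimate is then at most \<open>(i + 1) * M * \<delta>\<close>, hence at most \<open>T\<close>,
  and below \<open>T\<close> unless the frame ends.\<close>

lemma sketch_frame:
  fixes Z :: "nat \<Rightarrow> 'a fast"
  assumes Z0: "Z 0 = fast_init"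
    and st: "\<And>i. i < l \<Longrightarrow> sketch_step M \<delta> \<phi> T (p i) (Z i) (Z (Suc i)) (e i)"
    and weight: "\<And>i d w. i < l \<Longrightarrow> p i = Some (d, w) \<Longrightarrow> w \<le> M"
    and "l \<le> W" and T: "real T = real W * real M * \<delta>" and "M > 0" and "M \<le> T"
    and "\<delta> > 0" and "\<phi> \<ge> 0"
  shows "overflow_frame T W l (\<lambda>i. fast_query M \<delta> \<phi> (Z i) x) (\<lambda>i. packet_weight x (p i))
    (\<lambda>i. e i = Some x)"
proof -
  have inv: "fast_inv M \<delta> \<phi> i (Z i)" if "i \<le> l" for i
    using that
  proof (induction i)
    case 0
    then show ?case using Z0 fast_inv_init assms by simp
  next
    case (Suc i)
    then have IH: "fast_inv M \<delta> \<phi> i (Z i)" and i: "i < l" by simp_all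
    show ?case
    proof (cases "p i")
      case None
      then show ?thesis using st[OF i] fast_inv_mono[OF IH] by (simp add: sketch_step_def)
    next
      case (Some dw)
      obtain d w where "p i = Some (d, w)" using Some by (cases dw) auto
      then show ?thesis
        using st[OF i] fast_inv_add[OF IH] weight[OF i] assms(8,9) by (auto simp: sketch_step_def)
    qed
  qed
  show ?thesis
  proof
    show "T > 0" using assms by simp
    show "l \<le> W" by fact
    show "fast_query M \<delta> \<phi> (Z 0) x = 0"
      using fast_capacity_pos[of \<delta> \<phi>] assms by (simp add: Z0 fast_init_def fast_query_def)
  next
    fix i assume i: "i < l"
    show "packet_weight x (p i) \<le> T"
      using weight[OF i] assms(7) by (auto simp: packet_weight_def split: option.split)
    let ?q = "\<lambda>i. fast_query M \<delta> \<phi> (Z i) x"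
    let ?L = "?q (Suc i) = ?q i + packet_weight x (p i) \<and> (e i = Some x) = (?q i div T < ?q (Suc i) div T)"
    let ?R = "packet_weight x (p i) = 0 \<and> e i \<noteq> Some x \<and> ?q i \<le> ?q (Suc i) \<and> ?q (Suc i) \<le> T \<and>
       (Suc i < W \<longrightarrow> ?q (Suc i) < T)"
    show "?L \<or> ?R"
    proof (cases "p i")
      case None
      then show ?thesis using st[OF i] by (simp add: sketch_step_def packet_weight_def)
    next
      case (Some dw)
      then obtain d w where p: "p i = Some (d, w)" by (cases dw) auto
      have add: "fast_add M \<delta> \<phi> d w (Z i) (Z (Suc i))"
        and e: "e i = (if fast_query M \<delta> \<phi> (Z (Suc i)) d div T > fast_query M \<delta> \<phi> (Z i) d div T then Some d else None)"
        using st[OF i] p by (simp_all add: sketch_step_def)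
      have invi: "fast_inv M \<delta> \<phi> i (Z i)" and invS: "fast_inv M \<delta> \<phi> (Suc i) (Z (Suc i))"
        using inv i by simp_all
      show ?thesis
      proof (cases "d = x")
        case True
        then show ?thesis
          using fast_query_add_same[OF invi add assms(9)] e p by (simp add: packet_weight_def)
      next
        case dx: False
        then have w0: "packet_weight x (p i) = 0" and ex: "e i \<noteq> Some x"
          using p e by (simp_all add: packet_weight_def)
        note other = fast_query_add_other[OF invi add assms(9,8) dx[symmetric]]
        show ?thesis
        proof (cases "x \<in> ids (Z (Suc i))")
          case True
          then show ?thesis using other w0 ex by simp
        next
          case False
          have q: "real (?q (Suc i)) \<le> real (Suc i) * real M * \<delta>"
            using fast_query_untracked_le[OF invS assms(9,8) False] .
          have "real (Suc i) * real M * \<delta> \<le> real W * real M * \<delta>"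
            using i assms(4,8) by (intro mult_right_mono) auto
          then have "?q (Suc i) \<le> T" using q T by linarith
          moreover have "?q (Suc i) < T" if "Suc i < W"
          proof -
            have "real (Suc i) * real M * \<delta> < real W * real M * \<delta>"
              using that assms(6,8) by (intro mult_strict_right_mono) auto
            then show ?thesis using q T by linarith
          qed
          ultimately show ?thesis using other(1) w0 ex by simp
        qed
      qed
    qed
  qed
qed

text \<open>A length \<open>l\<close> below \<open>W\<close> admits the unfinished current frame.
  The estimate at position \<open>i\<close> is the one before packet \<open>s + i\<close>, so
  position 0 is the flushed sketch.\<close>

lemma history_frame:
  assumes h: "wfast_history W M \<epsilon> \<phi> ps Y ev" and "W dvd s" and "l \<le> W"
    and "s + l \<le> Suc (W + length ps)" and weight: "\<And>d w. (d, w) \<in> set ps \<Longrightarrow> w \<le> M"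
    and "W > 0" "M > 0" "\<phi> \<ge> 0" "wfast_blocks \<epsilon> > 0" "wfast_blocks \<epsilon> dvd W"
  shows "overflow_frame (wfast_unit W M \<epsilon>) W l
    (\<lambda>i. wfast_query M \<epsilon> \<phi> (if i = 0 then fast_init else Y (s + i - 1)) x)
    (\<lambda>i. packet_weight x (padded W ps (s + i))) (\<lambda>i. ev (s + i) = Some x)"
  unfolding wfast_query_def
proof (rule sketch_frame)
  let ?k = "wfast_blocks \<epsilon>"
  obtain L where L: "W = ?k * L" using assms(10) by blast
  have unit: "wfast_unit W M \<epsilon> = M * L"
    using assms(9) by (simp add: wfast_unit_def L mult.left_commute[of M])
  show "real (wfast_unit W M \<epsilon>) = real W * real M * (1 / real ?k)"
    using assms(9) unfolding unit by (subst L) simp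
  have "L > 0" using L assms(6) by (cases L) auto
  then show "M \<le> wfast_unit W M \<epsilon>" by (simp add: unit)
  fix i assume i: "i < l"
  have "(s + i) mod W = i" using assms(2,3) i by (auto simp: mod_add_eq[symmetric, of s] elim!: dvdE)
  then have before: "sketch_before W Y (s + i) = (if i = 0 then fast_init else Y (s + i - 1))"
    by (simp add: sketch_before_def)
  have "s + i \<le> W + length ps" using i assms(4) by simp
  then have step: "sketch_step M (1 / real ?k) \<phi> (wfast_unit W M \<epsilon>) (padded W ps (s + i))
      (if i = 0 then fast_init else Y (s + i - 1)) (Y (s + i)) (ev (s + i))"
    using h unfolding wfast_history_def before[symmetric] by blast
  show "sketch_step M (1 / real ?k) \<phi> (wfast_unit W M \<epsilon>) (padded W ps (s + i))
      (if i = 0 then fast_init else Y (s + i - 1))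
      (if Suc i = 0 then fast_init else Y (s + Suc i - 1)) (ev (s + i))"
    using step by simp
  show "w \<le> M" if "padded W ps (s + i) = Some (d, w)" for d w
    using padded_in_set[OF that] by (rule weight)
qed (use assms in auto)

section \<open>The window in shifted time and the final bounds\<close>

lemma card_shift: "card {i \<in> {a..<b}. P (s + i)} = card {i \<in> {s + a..<s + b :: nat}. P i}"
  by (rule bij_betw_same_card[where f = "(+) s"], rule bij_betw_byWitness[where f' = "\<lambda>i. i - s"]) auto

text \<open>The list entry \<open>i\<close> arrives at time \<open>i + W + 1\<close>. Padding times
  weigh nothing, which matches the truncation of the window for short streams.\<close>

lemma window_volume_eq:
  "window_volume W ps x = (\<Sum>i\<in>{Suc (length ps)..<Suc (W + length ps)}. packet_weight x (padded W ps i))"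
  unfolding window_volume_def
  by (rule sum.reindex_bij_witness_not_neutral[where S' = "{}" and i = "\<lambda>i. i - W - 1" and j = "\<lambda>i. i + W + 1"
      and T' = "{i \<in> {Suc (length ps)..<Suc (W + length ps)}. i \<le> W \<or> fst (ps ! (i - W - 1)) \<noteq> x}"])
    (auto simp: packet_weight_def padded_def split: prod.split)


theorem theorem4:
  fixes U :: "'a set" and W M :: nat and \<epsilon> \<phi> :: real
    and ps :: "('a \<times> nat) list" and st :: "'a wfast" and x :: 'a
  assumes "W > 0" and "M > 0" and "\<epsilon> > 0" and "\<phi> \<ge> 0"
    and "wfast_blocks \<epsilon> dvd W"
    and "weighted_stream U M ps"
    and "wfast_run W M \<epsilon> \<phi> ps st"
    and "x \<in> U"
  shows "real (window_volume W ps x) \<le> real_of_int (win_query W M \<epsilon> \<phi> st x)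
    \<and> real_of_int (win_query W M \<epsilon> \<phi> st x)
        \<le> real (window_volume W ps x) + real W * real M * \<epsilon>"
proof -
  define k L T where "k = wfast_blocks \<epsilon>" and "L = W div k" and "T = wfast_unit W M \<epsilon>"
  have k: "k > 0" using assms(3) by (simp add: k_def wfast_blocks_def)
  have LW: "W = k * L" using assms(5) by (simp add: L_def k_def)
  have L: "L > 0" using LW assms(1) by (cases L) auto
  have T: "T = M * L"
    using k unfolding T_def wfast_unit_def k_def[symmetric] LW by (simp add: mult.left_commute[of M])
  define n where "n = W + length ps"
  obtain Y ev where h: "wfast_history W M \<epsilon> \<phi> ps Y ev" and sk: "sketch st = Y n"
    and qs: "queues st = queue_state ev L k n" and tab: "table st = table_of (queues st)"
    using wfast_run_history[OF assms(7,1) _ assms(5)] k unfolding n_def L_def k_def by blast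
  have weight: "w \<le> M" if "(d, w) \<in> set ps" for d w
    using assms(6) that by (auto simp: weighted_stream_def)
  \<comment> \<open>The previous frame will start at \<open>s = f * W\<close> and the current one at
    \<open>s + W\<close>, with \<open>r + 1\<close> times so far. The padding gives
    \<open>n >= W\<close>, so a previous frame always exists.\<close>
  define r f where "r = n mod W" and "f = n div W - 1"
  have "n div W = Suc f" using assms(1) by (simp add: n_def f_def)
  then have n: "n = f * W + W + r" and rW: "r < W"
    using assms(1) div_mult_mod_eq[of n W] by (simp_all add: r_def)
  define s where "s = f * W"
  have n: "n = s + W + r" using n s_def by simp
  note frame = history_frame[OF h _ _ _ weight assms(1,2,4) k[unfolded k_def] assms(5)]
  interpret old: overflow_frame T W W
    "\<lambda>i. wfast_query M \<epsilon> \<phi> (if i = 0 then fast_init else Y (s + i - 1)) x"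
    "\<lambda>i. packet_weight x (padded W ps (s + i))" "\<lambda>i. ev (s + i) = Some x"
    unfolding T_def by (rule frame) (use n in \<open>auto simp: s_def simp flip: n_def\<close>)
  interpret cur: overflow_frame T W "Suc r"
    "\<lambda>i. wfast_query M \<epsilon> \<phi> (if i = 0 then fast_init else Y (s + W + i - 1)) x"
    "\<lambda>i. packet_weight x (padded W ps (s + W + i))" "\<lambda>i. ev (s + W + i) = Some x"
    unfolding T_def by (rule frame) (use n rW in \<open>auto simp: s_def simp flip: n_def\<close>)
  define q where "q = wfast_query M \<epsilon> \<phi> (Y n) x"
  have q: "wfast_query M \<epsilon> \<phi> (if Suc r = 0 then fast_init else Y (s + W + Suc r - 1)) x = q"
    by (simp add: q_def n)
  define vol where "vol a b = (\<Sum>i\<in>{a..<b}. packet_weight x (padded W ps i))" for a b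
  define ovf where "ovf a b = card {i \<in> {a..<b}. ev i = Some x}" for a b
  have vol_shift: "(\<Sum>i\<in>{a..<b}. packet_weight x (padded W ps (t + i))) = vol (t + a) (t + b)" for a b t
    unfolding vol_def using sum.shift_bounds_nat_ivl[of "\<lambda>i. packet_weight x (padded W ps i)" a t b]
    by (simp add: add.commute)
  have old_ovf: "old.overflows a b = ovf (s + a) (s + b)"
    and cur_ovf: "cur.overflows a b = ovf (s + W + a) (s + W + b)" for a b
    by (simp_all only: old.overflows_def cur.overflows_def ovf_def
        card_shift[where P = "\<lambda>i. ev i = Some x"])
  have vol_split: "vol a c = vol a b + vol b c" if "a \<le> b" "b \<le> c" for a b c
    using that by (simp add: vol_def sum.atLeastLessThan_concat)
  have ovf_split: "ovf a c = ovf a b + ovf b c" if "a \<le> b" "b \<le> c" for a b c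
  proof -
    have "{i \<in> {a..<c}. ev i = Some x} = {i \<in> {a..<b}. ev i = Some x} \<union> {i \<in> {b..<c}. ev i = Some x}"
      using that by auto
    moreover have "card ({i \<in> {a..<b}. ev i = Some x} \<union> {i \<in> {b..<c}. ev i = Some x}) = ovf a b + ovf b c"
      unfolding ovf_def by (rule card_Un_disjoint) auto
    ultimately show ?thesis by (simp only: ovf_def)
  qed
  \<comment> \<open>The oldest block contains time \<open>s + r\<close> and ends just before
    \<open>t\<close>; from \<open>t\<close> on the queues are complete. The window starts at
    \<open>s + r + 1\<close>, fewer than \<open>L\<close> times before \<open>t\<close>.\<close>
  define a t where "a = (r div L + 1) * L" and "t = s + a"
  have "r div L < k" using rW LW by (simp add: less_mult_imp_div_less)
  then have aW: "a \<le> W" unfolding a_def LW by (simp add: Suc_leI mult_le_mono1 del: mult_Suc)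
  have ra: "Suc r \<le> a" "a \<le> r + L"
    using div_mult_mod_eq[of r L] mod_less_divisor[OF L, of r] unfolding a_def add_mult_distrib
    by linarith+
  define B where "B = count_list (concat (queues st)) x"
  have kn: "k \<le> n div L" using L LW by (simp add: n_def less_eq_div_iff_mult_less_eq)
  have "n div L = f * k + k + r div L"
    using L by (simp add: n s_def LW div_add1_eq mult.assoc[symmetric])
  then have t: "(Suc (n div L) - k) * L = t"
    by (simp add: t_def a_def s_def LW algebra_simps)
  have none: "\<And>i. i > n \<Longrightarrow> ev i = None" using h by (simp add: wfast_history_def n_def)
  have Sn_diff: "Suc n - W = s + Suc r" by (simp add: n)
  have B: "ovf t (Suc n) \<le> B" "B \<le> ovf (s + Suc r) (Suc n)"
    using count_queue_state[where n = n and ev = ev and L = L and k = k and x = x, OF none L k kn]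
    by (simp_all only: B_def qs t ovf_def LW[symmetric] Sn_diff)

  define V where "V = window_volume W ps x"
  have V: "V = vol (s + Suc r) (s + W) + vol (s + W) (Suc n)"
    using rW n vol_split[of "s + Suc r" "s + W" "Suc n"]
    by (simp add: V_def window_volume_eq vol_def n_def)
  have V_old: "vol (s + Suc r) (s + W) = vol (s + Suc r) t + vol t (s + W)"
    using ra aW by (intro vol_split) (simp_all add: t_def)
  have "packet_weight x (padded W ps i) \<le> M" for i
  proof (cases "padded W ps i")
    case (Some dw)
    obtain d w where dw: "dw = (d, w)" by (cases dw)
    have "w \<le> M" using padded_in_set[OF Some] weight unfolding dw by blast
    then show ?thesis by (simp add: packet_weight_def Some dw)
  qed (simp add: packet_weight_def)
  then have "vol (s + Suc r) t \<le> card {s + Suc r..<t} * M"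
    unfolding vol_def using sum_bounded_above[of "{s + Suc r..<t}" _ M] by (metis of_nat_id)
  also have "\<dots> \<le> L * M" using ra by (intro mult_le_mono1) (simp add: t_def)
  finally have V_gap: "vol (s + Suc r) t \<le> T" by (simp add: T mult.commute)
  have V_recent: "vol t (s + W) \<le> T * (ovf t (s + W) + 1)"
    using old.volume_le_overflows[of a W] aW by (simp add: vol_shift old_ovf t_def)
  have old_le: "T * ovf (s + Suc r) (s + W) \<le> vol (s + Suc r) (s + W) + T"
    using old.overflows_le[of "Suc r" W] rW by (simp only: vol_shift old_ovf)
  have Sn: "s + W + Suc r = Suc n" by (simp add: n)
  have cur_vol: "vol (s + W) (Suc n) \<le> q"
    using cur.volume_le[of 0 "Suc r"] cur.q_0 by (simp only: vol_shift q Sn) (simp add: q_def)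
  have cur_q: "q \<le> vol (s + W) (Suc n) + T"
    using cur.q_le[of 0 "Suc r"] cur.q_0 by (simp only: vol_shift q Sn) (simp add: q_def)
  have cur_lo: "T * ovf (s + W) (Suc n) \<le> q" and cur_hi: "q \<le> T * (ovf (s + W) (Suc n) + 1)"
    using cur.overflows_bounds[of "Suc r"] by (simp_all only: cur_ovf q Sn) (simp_all add: q_def)
  have cur_div: "q div T = ovf (s + W) (Suc n)" if "Suc r < W"
    using cur.div_eq_overflows[of "Suc r"] that by (simp only: cur_ovf q Sn) (simp add: q_def)
  have O_hi: "ovf (s + Suc r) (Suc n) = ovf (s + Suc r) (s + W) + ovf (s + W) (Suc n)"
    using rW n by (intro ovf_split) simp_all
  have O_lo: "ovf t (Suc n) = ovf t (s + W) + ovf (s + W) (Suc n)"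
    using aW n by (intro ovf_split) (simp_all add: t_def)

  \<comment> \<open>This is the answer in natural numbers; an absent table entry is the case
    \<open>B = 0\<close>.\<close>
  define R where "R = (if B = 0 then 2 * T + q else T * (B + 2) + q mod T)"
  have win: "win_query W M \<epsilon> \<phi> st x = int R"
    by (simp add: win_query_def tab table_of_def Let_def R_def B_def[symmetric] sk q_def T_def
        algebra_simps)
  have q_mod: "q = T * (q div T) + q mod T" by simp

  have lower: "V \<le> R"
  proof (cases "Suc r < W")
    case True
    \<comment> \<open>One \<open>T\<close> pays for the window inside the oldest block, the other
      for volume after \<open>t\<close> in the previous frame that caused no overflow.\<close>
    have "V \<le> T + T * (ovf t (s + W) + 1) + q" using V V_old V_gap V_recent cur_vol by linarith
    also have "\<dots> = T * (ovf t (Suc n) + 2) + q mod T"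
      using q_mod cur_div[OF True] O_lo by (simp add: algebra_simps)
    also have "\<dots> \<le> T * (B + 2) + q mod T" using B(1) by simp
    also have "\<dots> \<le> R" by (simp add: R_def)
    finally show ?thesis .
  next
    case False
    \<comment> \<open>Now \<open>Suc r = W\<close>: the window is exactly the current frame. The
      equation \<open>cur_div\<close> may fail here, but the previous frame needs no allowance and
      \<open>cur_hi\<close> suffices.\<close>
    then have "V \<le> q" using V rW cur_vol by (simp add: vol_def)
    also have "q \<le> T * (ovf (s + W) (Suc n) + 1)" by (fact cur_hi)
    also have "\<dots> \<le> T * (B + 2)" using B(1) O_lo by (intro mult_le_mono2) simp
    finally show ?thesis using \<open>V \<le> q\<close> by (simp add: R_def)
  qed
  have upper: "R \<le> V + 4 * T"
  proof (cases "B = 0")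
    case True
    then show ?thesis using cur_q V by (simp add: R_def)
  next
    case False
    have "ovf (s + W) (Suc n) \<le> q div T"
      using cur_lo old.T_pos by (simp add: less_eq_div_iff_mult_less_eq mult.commute)
    then have "T * ovf (s + W) (Suc n) \<le> T * (q div T)" by simp
    \<comment> \<open>Of the \<open>4 * T\<close>, two come from the answer itself, one from the
      overflows of the previous frame and one from the current estimate \<open>q\<close>.\<close>
    moreover have "T * B \<le> T * ovf (s + Suc r) (s + W) + T * ovf (s + W) (Suc n)"
      using B(2) O_hi by (metis distrib_left mult_le_mono2)
    ultimately have "T * B + q mod T \<le> vol (s + Suc r) (s + W) + T + q"
      using q_mod old_le by linarith
    then show ?thesis using False cur_q V by (simp add: R_def)
  qed
  \<comment> \<open>The choice of \<open>k\<close> as at least \<open>4 / \<epsilon>\<close> turns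
    an error of four units \<open>M * W / k\<close> into the required accuracy.\<close>
  have "4 / \<epsilon> \<le> real k" unfolding k_def wfast_blocks_def by linarith
  then have "4 \<le> real k * \<epsilon>" using assms(3) by (simp add: pos_divide_le_eq)
  then have "real T * 4 \<le> real T * (real k * \<epsilon>)" by (intro mult_left_mono) auto
  also have "\<dots> = real W * real M * \<epsilon>" by (simp add: T LW)
  finally have "4 * real T \<le> real W * real M * \<epsilon>" by simp
  then show ?thesis using lower upper unfolding win V_def[symmetric] by simp
qed

end
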